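(* Fix $n\ge 1$ and let $\lambda_1,\lambda_2\in\mathbb{R}$ be such that $\lambda_1\lambda_2\ge 0$ and $|\lambda_1|\le|\lambda_2|$. Then $(1-\lambda_1D)e^{\lambda_1D}P\preccurlyeq(1-\lambda_2D)e^{\lambda_2D}P$ for every $P\in\mathcal{H}_n$.
   Context: $D=d/dx$, and $e^{\lambda D}=\sum_{k\ge0}\lambda^kD^k/k!$ acting on polynomials, so $e^{\lambda D}P(x)=P(x+\lambda)$. $\mathcal{H}_n$ denotes the set of monic univariate polynomials of degree $n$ all of whose zeros are real. For $P\in\mathcal{H}_n$, $\mathcal{Z}(P)$ is the unordered $n$-tuple of zeros of $P$ counted with multiplicity. Spectral order (classical majorization): for unordered real $n$-tuples $X=(x_1,\dots,x_n)$, $Y=(y_1,\dots,y_n)$ write $X\prec Y$ if $\sum_{i=1}^n f(x_i)\le\sum_{i=1}^n f(y_i)$ for every convex $f:\mathbb{R}\to\mathbb{R}$ (equivalently, $X=AY$ as column vectors for some doubly stochastic matrix $A$). For $P,Q\in\mathcal{H}_n$ write $Q\preccurlyeq P$ if $\mathcal{Z}(Q)\prec\mathcal{Z}(P)$. (The polynomials in the claim lie in $\mathcal{H}_n$ by the Hermite-Poulain theorem.) *)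

theory Defs
  imports
    "HOL-Analysis.Analysis"
    "HOL-Computational_Algebra.Computational_Algebra"
begin

text \<open>
  A monic polynomial with only real zeros has real coefficients, so real polynomials lose nothing.
  The zeros quantified over are the complex ones.
\<close>

definition hyperbolic_polys :: "nat \<Rightarrow> real poly set" where
  "hyperbolic_polys n = {p. degree p = n \<and> lead_coeff p = 1 \<and>
     (\<forall>z::complex. poly (map_poly of_real p) z = 0 \<longrightarrow> z \<in> \<real>)}"

text \<open>
  The real zeros exhaust all zeros, so that \<^const>\<open>proots\<close> of a polynomial in
  \<^term>\<open>hyperbolic_polys n\<close> is the unordered \<open>n\<close>-tuple of its zeros.
\<close>

lemma poly_map_poly_of_real:
  "poly (map_poly of_real p) (of_real x :: complex) = of_real (poly p x)"
  by (induction p) (auto simp: map_poly_pCons)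

lemma size_proots_hyperbolic:
  assumes "p \<in> hyperbolic_polys n"
  shows "size (proots p) = n"
proof -
  have "size (proots p) = n"
    if "degree p = n" "p \<noteq> 0" "\<And>z::complex. poly (map_poly of_real p) z = 0 \<Longrightarrow> z \<in> \<real>"
    for p :: "real poly"
    using that
  proof (induction n arbitrary: p)
    case 0
    then show ?case by (auto elim!: degree_eq_zeroE)
  next
    case (Suc n)
    have "degree (map_poly of_real p :: complex poly) = Suc n"
      using Suc.prems(1) by (simp add: degree_map_poly)
    then obtain z :: complex where z: "poly (map_poly of_real p) z = 0"
      using fundamental_theorem_of_algebra[of "map_poly of_real p"] by (auto simp: constant_degree)
    then obtain r where "z = of_real r"
      using Suc.prems(3) Reals_cases by metis
    with z have "poly p r = 0"
      by (simp add: poly_map_poly_of_real)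
    then obtain q where q: "p = [:-r, 1:] * q"
      by (auto simp: poly_eq_0_iff_dvd elim: dvdE)
    have q0: "q \<noteq> 0" using Suc.prems(2) q by auto
    have "degree q = n"
      using Suc.prems(1) q0 unfolding q by (subst (asm) degree_mult_eq) auto
    moreover have "z \<in> \<real>" if "poly (map_poly of_real q) z = 0" for z :: complex
    proof (rule Suc.prems(3))
      have "(map_poly of_real p :: complex poly) = map_poly of_real [:-r, 1:] * map_poly of_real q"
        unfolding q by (intro poly_eqI) (simp add: coeff_map_poly map_poly_pCons coeff_pCons split: nat.split)
      then show "poly (map_poly of_real p) z = 0" using that by simp
    qed
    ultimately have "size (proots q) = n" using q0 Suc.IH by blast
    then show ?case unfolding q using q0 by (subst proots_mult) auto
  qed
  then show ?thesis using assms by (force simp: hyperbolic_polys_def)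
qed

definition spectral_le :: "real multiset \<Rightarrow> real multiset \<Rightarrow> bool" (infix "\<prec>\<^sub>s" 50) where
  "X \<prec>\<^sub>s Y \<longleftrightarrow> size X = size Y \<and>
     (\<forall>f. convex_on UNIV f \<longrightarrow> (\<Sum>x\<in>#X. f x) \<le> (\<Sum>y\<in>#Y. f y))"

text \<open>A relation on \<^term>\<open>hyperbolic_polys n\<close>: both polynomials are required to lie in that set.\<close>

definition poly_spectral_le :: "nat \<Rightarrow> real poly \<Rightarrow> real poly \<Rightarrow> bool" where
  "poly_spectral_le n Q P \<longleftrightarrow>
     Q \<in> hyperbolic_polys n \<and> P \<in> hyperbolic_polys n \<and> proots Q \<prec>\<^sub>s proots P"

text \<open>The series of \<open>e\<^sup>\<lambda>\<^sup>D\<close> is cut off at the degree, beyond which all derivatives vanish.\<close>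

definition exp_D :: "real \<Rightarrow> real poly \<Rightarrow> real poly" where
  "exp_D l p = (\<Sum>k\<le>degree p. smult (l ^ k / fact k) ((pderiv ^^ k) p))"

definition one_minus_D :: "real \<Rightarrow> real poly \<Rightarrow> real poly" where
  "one_minus_D l p = p - smult l (pderiv p)"

lemma funpow_pderiv_eq_0:
  fixes p :: "real poly"
  assumes "degree p < k"
  shows "(pderiv ^^ k) p = 0"
  using assms
proof (induction k arbitrary: p)
  case (Suc k)
  show ?case
  proof (cases "degree p = 0")
    case True
    then have "pderiv p = 0" by (simp add: pderiv_eq_0_iff)
    moreover have "(pderiv ^^ m) (0 :: real poly) = 0" for m by (induction m) auto
    ultimately show ?thesis by (simp add: funpow_Suc_right del: funpow.simps)
  next
    case False
    then have "(pderiv ^^ k) (pderiv p) = 0"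
      using Suc by (simp add: degree_pderiv)
    then show ?thesis by (simp add: funpow_Suc_right del: funpow.simps)
  qed
qed simp

lemma poly_exp_D: "poly (exp_D l p) x = poly p (x + l)"
proof -
  have d: "DERIV (\<lambda>h. poly ((pderiv ^^ m) p) (x + h)) h :> poly ((pderiv ^^ Suc m) p) (x + h)" for m h
    by (auto intro!: derivative_eq_intros)
  obtain t where "poly p (x + l) =
      (\<Sum>m<Suc (degree p). poly ((pderiv ^^ m) p) (x + 0) / fact m * l ^ m)
      + poly ((pderiv ^^ Suc (degree p)) p) (x + t) / fact (Suc (degree p)) * l ^ Suc (degree p)"
    using Maclaurin_all_le[of "\<lambda>m h. poly ((pderiv ^^ m) p) (x + h)" "\<lambda>h. poly p (x + h)" l
        "Suc (degree p)"] d by auto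
  moreover have "(pderiv ^^ Suc (degree p)) p = 0" by (rule funpow_pderiv_eq_0) simp
  ultimately show ?thesis
    by (simp add: exp_D_def poly_sum lessThan_Suc_atMost mult.commute del: funpow.simps)
qed

end

theory Submission
  imports Defs
begin

text \<open>
  Let \<open>l > 0\<close>, let \<open>P\<close> have simple zeros, and put \<open>R = P - l P'\<close>, with zeros \<open>y\<^sub>i\<close> depending on \<open>l\<close>.
  The zeros of \<open>(1 - l D) e\<^sup>l\<^sup>D P\<close> are \<open>x\<^sub>i = y\<^sub>i - l\<close>. They move with velocity \<open>c\<^sub>i - 1\<close>, where
  \<open>c\<^sub>i = P'(y\<^sub>i) / R'(y\<^sub>i) > 0\<close>, and comparing \<open>P = R + l P'\<close> with the interpolation of \<open>P'\<close>
  at the \<open>y\<^sub>i\<close> gives \<open>c\<^sub>i - 1 = l \<Sum>\<^sub>j (c\<^sub>i + c\<^sub>j) / (y\<^sub>i - y\<^sub>j)\<close>. The summands are antisymmetric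
  in \<open>i\<close> and \<open>j\<close> and the zeros repel, so \<open>\<Sum> s\<^sub>i x\<^sub>i\<close> increases with \<open>l\<close> for all nondecreasing
  weights \<open>s\<^sub>i\<close>. Subgradients of a convex \<open>f\<close> at the zeros for the smaller parameter are such
  weights, whence \<open>\<Sum> f x\<^sub>i\<close> increases. Multiple zeros and \<open>l = 0\<close> follow by perturbation and
  compactness, negative \<open>l\<close> by reflection.
\<close>

subsection \<open>Polynomials given by their roots\<close>

text \<open>Indexing by a family allows repeated zeros; the identity family on \<open>A\<close>
  gives simple ones. For infinite \<open>I\<close> the product is 1 and \<open>card I\<close> is 0,
  so the degree is right for every \<open>I\<close>.\<close>

definition root_poly :: "'i set \<Rightarrow> ('i \<Rightarrow> 'a::comm_ring_1) \<Rightarrow> 'a poly" where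
  "root_poly I p = (\<Prod>i\<in>I. [:- p i, 1:])"

lemma poly_root_poly: "poly (root_poly I p) x = (\<Prod>i\<in>I. x - p i)"
  by (simp add: root_poly_def poly_prod)

lemma root_poly_nonzero [simp]: "root_poly I (p :: _ \<Rightarrow> 'a::idom) \<noteq> 0"
  by (cases "finite I") (auto simp: root_poly_def)

lemma degree_root_poly [simp]: "degree (root_poly I (p :: _ \<Rightarrow> 'a::idom)) = card I"
  unfolding root_poly_def by (subst degree_prod_eq_sum_degree) auto

lemma coeff_root_poly_card [simp]: "coeff (root_poly I (p :: _ \<Rightarrow> 'a::idom)) (card I) = 1"
proof -
  have "lead_coeff (root_poly I p) = 1"
    unfolding root_poly_def lead_coeff_prod by simp
  then show ?thesis by simp
qed

lemma proots_root_poly: "proots (root_poly I (p :: _ \<Rightarrow> 'a::idom)) = image_mset p (mset_set I)"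
proof -
  have "proots (root_poly I p) = (\<Sum>i\<in>I. {#p i#})"
    unfolding root_poly_def by (subst proots_prod) auto
  then show ?thesis
    by (simp add: sum_unfold_sum_mset)
qed

lemma pderiv_root_poly: "pderiv (root_poly I (p :: _ \<Rightarrow> 'a::idom)) = (\<Sum>i\<in>I. root_poly (I - {i}) p)"
  by (simp add: root_poly_def pderiv_prod pderiv_pCons)

lemma poly_root_poly_remove:
  fixes p :: "_ \<Rightarrow> 'a::field"
  assumes "finite I" "i \<in> I" "x \<noteq> p i"
  shows "poly (root_poly (I - {i}) p) x = poly (root_poly I p) x / (x - p i)"
  using assms by (simp add: poly_root_poly prod.remove[of I i])

lemma poly_pderiv_root_poly:
  fixes p :: "_ \<Rightarrow> 'a::field"
  assumes "finite I" "x \<notin> p ` I"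
  shows "poly (pderiv (root_poly I p)) x = poly (root_poly I p) x * (\<Sum>i\<in>I. 1 / (x - p i))"
  unfolding pderiv_root_poly poly_sum sum_distrib_left
  using assms by (intro sum.cong) (auto simp: poly_root_poly_remove image_iff)

lemma poly_pderiv_root_poly_root:
  fixes p :: "_ \<Rightarrow> 'a::idom"
  assumes "finite I" "i \<in> I"
  shows "poly (pderiv (root_poly I p)) (p i) = poly (root_poly (I - {i}) p) (p i)"
proof -
  have "root_poly I p = [:- p i, 1:] * root_poly (I - {i}) p"
    using assms unfolding root_poly_def by (rule prod.remove)
  then show ?thesis by (simp only:) (simp add: pderiv_mult pderiv_pCons del: mult_pCons_left)
qed

lemma map_poly_of_real_mult:
  "(map_poly of_real (p * q) :: complex poly) = map_poly of_real p * map_poly of_real q"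
  by (intro poly_eqI) (simp add: coeff_map_poly coeff_mult)

lemma map_poly_of_real_root_poly:
  "(map_poly of_real (root_poly I p) :: complex poly) = root_poly I (\<lambda>i. of_real (p i))"
  by (induction I rule: infinite_finite_induct)
     (simp_all add: root_poly_def map_poly_of_real_mult map_poly_pCons del: mult_pCons_left)

lemma root_poly_hyperbolic: "root_poly I p \<in> hyperbolic_polys (card I)"
proof (cases "finite I")
  case True
  then show ?thesis
    by (auto simp: hyperbolic_polys_def map_poly_of_real_root_poly poly_root_poly)
next
  case False
  then show ?thesis
    by (simp add: hyperbolic_polys_def root_poly_def)
qed

lemma prod_mset_proots:
  fixes P :: "real poly"
  assumes "size (proots P) = degree P" "lead_coeff P = 1"
  shows "P = (\<Prod>x\<in>#proots P. [:- x, 1:])"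
  using assms
proof (induction "degree P" arbitrary: P)
  case 0
  then show ?case by (auto elim!: degree_eq_zeroE)
next
  case (Suc n)
  have "P \<noteq> 0" using Suc.prems by auto
  have "proots P \<noteq> {#}" using Suc by auto
  then obtain r where "r \<in># proots P" by blast
  then have "poly P r = 0" using \<open>P \<noteq> 0\<close> by simp
  then obtain q where q: "P = [:-r, 1:] * q"
    by (auto simp: poly_eq_0_iff_dvd elim: dvdE)
  have "q \<noteq> 0" using \<open>P \<noteq> 0\<close> q by auto
  have "degree P = Suc (degree q)"
    using \<open>q \<noteq> 0\<close> unfolding q by (subst degree_mult_eq) auto
  moreover have pr: "proots P = add_mset r (proots q)"
    using \<open>q \<noteq> 0\<close> unfolding q by (subst proots_mult) auto
  moreover have "lead_coeff q = 1"
    using Suc.prems(2) unfolding q lead_coeff_mult by simp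
  ultimately have "q = (\<Prod>x\<in>#proots q. [:- x, 1:])"
    using Suc.hyps Suc.prems by auto
  then show ?case unfolding pr using q by simp
qed

text \<open>Sorting the zeros makes the family nondecreasing, so that adding positive multiples of
  the index separates them later.\<close>

lemma hyperbolic_polysE:
  assumes "P \<in> hyperbolic_polys n"
  obtains p where "P = root_poly {..<n} p" "mono_on {..<n} p"
proof -
  define xs where "xs = sorted_list_of_multiset (proots P)"
  have len: "length xs = n"
    using size_proots_hyperbolic[OF assms] unfolding xs_def
    by (metis mset_sorted_list_of_multiset size_mset)
  have "P = (\<Prod>x\<in>#proots P. [:- x, 1:])"
    using assms size_proots_hyperbolic[OF assms]
    by (intro prod_mset_proots) (auto simp: hyperbolic_polys_def)
  also have "\<dots> = prod_list (map (\<lambda>x. [:- x, 1:]) xs)"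
    unfolding xs_def
    by (metis mset_map mset_sorted_list_of_multiset prod_mset_prod_list)
  also have "\<dots> = root_poly {..<n} ((!) xs)"
    by (simp add: prod.list_conv_set_nth root_poly_def len lessThan_atLeast0)
  finally show ?thesis
    using that[of "(!) xs"] len sorted_sorted_list_of_multiset[of "proots P"]
    by (auto simp: mono_on_def xs_def sorted_nth_mono)
qed

section \<open>The Hermite-Poulain theorem and the translation by \<open>l\<close>\<close>

lemma map_poly_of_real_one_minus_D:
  "(map_poly of_real (one_minus_D l P) :: complex poly) =
     map_poly of_real P - smult (of_real l) (pderiv (map_poly of_real P))"
  by (intro poly_eqI) (simp add: one_minus_D_def coeff_map_poly coeff_pderiv)

text \<open>The sum is the logarithmic derivative P'/P; for finite nonempty \<open>I\<close> it is
  therefore never real off the real axis.\<close>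

lemma Im_sum_inverse:
  "Im (\<Sum>i\<in>I. 1 / (z - of_real (p i))) = - Im z * (\<Sum>i\<in>I. 1 / (norm (z - of_real (p i)))\<^sup>2)"
  by (simp add: sum_distrib_left Im_divide cmod_power2)

lemma degree_one_minus_D [simp]: "degree (one_minus_D l P) = degree P"
  and coeff_degree_one_minus_D [simp]: "coeff (one_minus_D l P) (degree P) = lead_coeff P"
proof -
  have c: "coeff (one_minus_D l P) (degree P) = coeff P (degree P)"
    by (simp add: one_minus_D_def coeff_pderiv coeff_eq_0)
  have "degree (one_minus_D l P) \<le> degree P"
    unfolding one_minus_D_def
    by (intro degree_diff_le order.trans[OF degree_smult_le]) (auto simp: degree_pderiv)
  moreover have "degree P \<le> degree (one_minus_D l P)"
    using c by (cases "P = 0") (auto intro!: le_degree)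
  ultimately show "degree (one_minus_D l P) = degree P" by simp
  show "coeff (one_minus_D l P) (degree P) = lead_coeff P" by (rule c)
qed

text \<open>At a nonreal zero \<open>z\<close> of P - l P' the value P(z) is nonzero, so l
  P'(z)/P(z) = 1 is real, which contradicts the formula for the imaginary part of P'/P.\<close>

lemma one_minus_D_hyperbolic:
  assumes "P \<in> hyperbolic_polys n"
  shows "one_minus_D l P \<in> hyperbolic_polys n"
proof -
  obtain p where P: "P = root_poly {..<n} p"
    using hyperbolic_polysE[OF assms] .
  have "z \<in> \<real>" if z: "poly (map_poly of_real (one_minus_D l P)) z = 0" for z :: complex
  proof (rule ccontr)
    assume "z \<notin> \<real>"
    let ?P = "root_poly {..<n} (\<lambda>i. of_real (p i) :: complex)"
    let ?g = "\<Sum>i<n. 1 / (z - of_real (p i))"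
    have nz: "z \<notin> (\<lambda>i. of_real (p i)) ` {..<n}"
      using \<open>z \<notin> \<real>\<close> by auto
    then have "poly ?P z \<noteq> 0"
      by (auto simp: poly_root_poly)
    moreover have "poly ?P z - of_real l * (poly ?P z * ?g) = 0"
      using z nz unfolding P map_poly_of_real_one_minus_D
      by (simp add: map_poly_of_real_root_poly poly_pderiv_root_poly)
    ultimately have g: "of_real l * ?g = 1"
      by (simp add: algebra_simps)
    have "l * Im ?g = Im (of_real l * ?g)" by simp
    also have "\<dots> = 0" unfolding g by simp
    finally have "l * (Im z * (\<Sum>i<n. 1 / (norm (z - of_real (p i)))\<^sup>2)) = 0"
      unfolding Im_sum_inverse by simp
    moreover have "l \<noteq> 0" using g by auto
    moreover have "Im z \<noteq> 0" using \<open>z \<notin> \<real>\<close> by (simp add: complex_is_Real_iff)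
    moreover have "n \<noteq> 0" using g by (intro notI) simp
    moreover have "1 / (norm (z - of_real (p i)))\<^sup>2 > 0" if "i < n" for i
      using nz that by auto
    ultimately show False
      using sum_pos[of "{..<n}" "\<lambda>i. 1 / (norm (z - of_real (p i)))\<^sup>2"] by force
  qed
  then show ?thesis using assms by (auto simp: hyperbolic_polys_def)
qed

text \<open>Translation by \<open>l\<close> commutes with differentiation.\<close>

lemma poly_one_minus_D_exp_D:
  "poly (one_minus_D l (exp_D l P)) x = poly (one_minus_D l P) (x + l)"
proof -
  have e: "exp_D l P = pcompose P [:l, 1:]"
    by (subst poly_eq_poly_eq_iff[symmetric]) (auto simp: fun_eq_iff poly_exp_D poly_pcompose add.commute)
  show ?thesis
    unfolding e one_minus_D_def by (simp add: pderiv_pcompose pderiv_pCons poly_pcompose add.commute)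
qed

lemma one_minus_D_exp_D_root_poly:
  assumes "one_minus_D l P = root_poly I y"
  shows "one_minus_D l (exp_D l P) = root_poly I (\<lambda>i. y i - l)"
proof -
  have "poly (one_minus_D l (exp_D l P)) = poly (root_poly I (\<lambda>i. y i - l))"
    by (rule ext) (simp add: poly_one_minus_D_exp_D assms poly_root_poly algebra_simps)
  then show ?thesis by (simp add: poly_eq_poly_eq_iff)
qed

subsection \<open>Motion of simple zeros\<close>

text \<open>With R the monic polynomial with simple zero set \<open>Z\<close>, \<open>c y\<close> is
  the residue of P'/R at \<open>y\<close>. Differentiating P = R + l P' at \<open>y\<close> and
  inserting the Lagrange form of P' gives the identity after division by R'(y).\<close>

lemma residue_identity:
  fixes P :: "'a::field_char_0 poly"
  assumes "finite Z" and P: "P = root_poly Z (\<lambda>x. x) + smult l (pderiv P)"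
    and deg: "degree (pderiv P) < card Z"
    and c: "\<And>y. y \<in> Z \<Longrightarrow> poly (pderiv P) y = c y * poly (root_poly (Z - {y}) (\<lambda>x. x)) y"
    and "y \<in> Z"
  shows "c y - 1 = l * (\<Sum>z\<in>Z - {y}. (c y + c z) / (y - z))"
proof -
  define L where "L y = root_poly (Z - {y}) (\<lambda>x::'a. x)" for y
  have L0: "poly (L z) w = 0" if "w \<in> Z" "z \<noteq> w" for w z
    using that \<open>finite Z\<close> by (auto simp: L_def poly_root_poly)
  have L1: "poly (L y) y \<noteq> 0"
    using \<open>finite Z\<close> by (auto simp: L_def poly_root_poly)
  \<comment> \<open>Lagrange interpolation: both sides have degree below \<open>card Z\<close> and
    agree on \<open>Z\<close>.\<close>
  have dP: "pderiv P = (\<Sum>z\<in>Z. smult (c z) (L z))"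
  proof (rule poly_eqI_degree[where A = Z])
    fix w assume "w \<in> Z"
    have "(\<Sum>z\<in>Z. c z * poly (L z) w) = (\<Sum>z\<in>{w}. c z * poly (L z) w)"
      using \<open>w \<in> Z\<close> \<open>finite Z\<close> by (intro sum.mono_neutral_right) (auto simp: L0)
    then show "poly (pderiv P) w = poly (\<Sum>z\<in>Z. smult (c z) (L z)) w"
      using c[OF \<open>w \<in> Z\<close>] by (simp add: poly_sum L_def)
  next
    have "card Z > 0" using \<open>finite Z\<close> \<open>y \<in> Z\<close> by (auto simp: card_gt_0_iff)
    then have "degree (smult (c z) (L z)) < card Z" if "z \<in> Z" for z
      using that \<open>finite Z\<close> by (simp add: L_def)
    then show "degree (\<Sum>z\<in>Z. smult (c z) (L z)) < card Z"
      using \<open>card Z > 0\<close> by (intro degree_sum_less) auto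
  qed (rule deg)
  have L': "poly (pderiv (L y)) y = poly (L y) y * (\<Sum>z\<in>Z - {y}. 1 / (y - z))"
    unfolding L_def using \<open>finite Z\<close> by (intro poly_pderiv_root_poly) auto
  \<comment> \<open>\<open>L z\<close> has the simple zero \<open>y\<close>, so its derivative there
    omits the factor of \<open>y\<close>. Removing \<open>y\<close> first and \<open>z\<close>
    second expresses the result by \<open>L y\<close>.\<close>
  have Lz': "poly (pderiv (L z)) y = poly (L y) y / (y - z)" if "z \<in> Z - {y}" for z
  proof -
    have "poly (pderiv (L z)) y = poly (root_poly (Z - {z} - {y}) (\<lambda>x. x)) y"
      unfolding L_def using that \<open>finite Z\<close> \<open>y \<in> Z\<close>
      by (intro poly_pderiv_root_poly_root[where p = "\<lambda>x. x"]) auto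
    also have "Z - {z} - {y} = Z - {y} - {z}" by auto
    also have "poly (root_poly (Z - {y} - {z}) (\<lambda>x. x)) y = poly (L y) y / (y - z)"
      unfolding L_def using that \<open>finite Z\<close> by (intro poly_root_poly_remove) auto
    finally show ?thesis .
  qed
  have "poly (pderiv P) y = poly (pderiv (root_poly Z (\<lambda>x. x))) y + l * poly (pderiv (pderiv P)) y"
    by (subst P) (simp add: pderiv_add pderiv_smult)
  also have "poly (pderiv (root_poly Z (\<lambda>x. x))) y = poly (L y) y"
    unfolding L_def using \<open>finite Z\<close> \<open>y \<in> Z\<close>
    by (rule poly_pderiv_root_poly_root[where p = "\<lambda>x. x"])
  also have "poly (pderiv (pderiv P)) y = (\<Sum>z\<in>Z. c z * poly (pderiv (L z)) y)"
    unfolding dP by (simp add: higher_pderiv_sum[of 1, simplified] pderiv_smult poly_sum)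
  also have "\<dots> = c y * poly (pderiv (L y)) y + (\<Sum>z\<in>Z - {y}. c z * poly (pderiv (L z)) y)"
    using \<open>finite Z\<close> \<open>y \<in> Z\<close> by (rule sum.remove)
  also have "(\<Sum>z\<in>Z - {y}. c z * poly (pderiv (L z)) y)
      = poly (L y) y * (\<Sum>z\<in>Z - {y}. c z / (y - z))"
    unfolding sum_distrib_left by (intro sum.cong) (auto simp: Lz')
  also have "poly (pderiv P) y = c y * poly (L y) y"
    unfolding L_def by (rule c[OF \<open>y \<in> Z\<close>])
  finally have "poly (L y) y * (c y - 1) = poly (L y) y *
      (l * (c y * (\<Sum>z\<in>Z - {y}. 1 / (y - z)) + (\<Sum>z\<in>Z - {y}. c z / (y - z))))"
    unfolding L' by (simp add: algebra_simps)
  then have "c y - 1 = l * (c y * (\<Sum>z\<in>Z - {y}. 1 / (y - z)) + (\<Sum>z\<in>Z - {y}. c z / (y - z)))"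
    using L1 by simp
  also have "c y * (\<Sum>z\<in>Z - {y}. 1 / (y - z)) + (\<Sum>z\<in>Z - {y}. c z / (y - z))
      = (\<Sum>z\<in>Z - {y}. (c y + c z) / (y - z))"
    by (simp add: sum_distrib_left sum.distrib add_divide_distrib)
  finally show ?thesis .
qed

text \<open>Exchanging \<open>y\<close> and \<open>z\<close> in the double sum turns the weight
  \<open>s y\<close> into \<open>- s z\<close>. In the average of both forms,
  \<open>s y - s z\<close> never has the sign opposite to the kernel.\<close>

lemma sum_weighted_residues_nonneg:
  fixes c s :: "real \<Rightarrow> real"
  assumes "finite Z" "l \<ge> 0" and mono: "mono_on Z s"
    and c: "\<And>y. y \<in> Z \<Longrightarrow> c y \<ge> 0"
    and id: "\<And>y. y \<in> Z \<Longrightarrow> c y - 1 = l * (\<Sum>z\<in>Z - {y}. (c y + c z) / (y - z))"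
  shows "(\<Sum>y\<in>Z. s y * (c y - 1)) \<ge> 0"
proof -
  define K where "K y z = (c y + c z) / (y - z)" for y z
  \<comment> \<open>Division by zero makes \<open>K y y\<close> vanish, so the sum may run over all
    of \<open>Z\<close>.\<close>
  have K: "c y - 1 = l * (\<Sum>z\<in>Z. K y z)" if "y \<in> Z" for y
    unfolding id[OF that] using \<open>finite Z\<close> that by (subst (2) sum.remove[of _ y]) (auto simp: K_def)
  have "(\<Sum>y\<in>Z. s y * (c y - 1)) = l * (\<Sum>y\<in>Z. \<Sum>z\<in>Z. s y * K y z)"
    by (simp add: K sum_distrib_left mult_ac)
  moreover have "(\<Sum>y\<in>Z. \<Sum>z\<in>Z. s y * K y z) = (\<Sum>y\<in>Z. \<Sum>z\<in>Z. - s z * K y z)"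
  proof (subst sum.swap, intro sum.cong refl)
    fix y z show "s z * K z y = - s z * K y z"
      by (cases "y = z") (auto simp: K_def field_simps)
  qed
  ultimately have "2 * (\<Sum>y\<in>Z. s y * (c y - 1)) = l * (\<Sum>y\<in>Z. \<Sum>z\<in>Z. (s y - s z) * K y z)"
    by (simp add: algebra_simps sum.distrib sum_subtractf sum_negf)
  moreover have "(s y - s z) * K y z \<ge> 0" if "y \<in> Z" "z \<in> Z" for y z
  proof (cases y z rule: linorder_cases)
    case less
    then have "s y \<le> s z" using mono that by (auto simp: mono_on_def)
    then show ?thesis using c[OF that(1)] c[OF that(2)] less
      unfolding K_def by (intro mult_nonpos_nonpos divide_nonneg_neg) auto
  next
    case greater
    then have "s z \<le> s y" using mono that by (auto simp: mono_on_def)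
    then show ?thesis using c[OF that(1)] c[OF that(2)] greater
      unfolding K_def by (intro mult_nonneg_nonneg divide_nonneg_pos) auto
  qed (simp add: K_def)
  ultimately show ?thesis
    using \<open>l \<ge> 0\<close> by (smt (verit) mult_nonneg_nonneg sum_nonneg)
qed

section \<open>Zeros as inverse branches of the logarithmic derivative\<close>

text \<open>This is P'/P for P with simple zero set \<open>A\<close>. For \<open>l > 0\<close> the
  zeros of P - l P' are the solutions of \<open>recip_sum A y = 1 / l\<close> off
  \<open>A\<close>.\<close>

definition recip_sum :: "real set \<Rightarrow> real \<Rightarrow> real" where
  "recip_sum A y = (\<Sum>a\<in>A. 1 / (y - a))"

definition recip_square_sum :: "real set \<Rightarrow> real \<Rightarrow> real" where
  "recip_square_sum A y = (\<Sum>a\<in>A. 1 / (y - a)\<^sup>2)"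

text \<open>For finite nonempty \<open>A\<close> and \<open>k \<le> card A\<close> these are the
  open intervals cut out by \<open>A\<close>, numbered from the left; index 0 is the unbounded one
  on the left.\<close>

definition gap :: "real set \<Rightarrow> nat \<Rightarrow> real set" where
  "gap A k = {y. y \<notin> A \<and> card {a\<in>A. a < y} = k}"

text \<open>The argument is the reciprocal \<open>\<mu> = 1 / l\<close> of the parameter, so that
  each moving zero is an inverse function of \<open>recip_sum A\<close>.\<close>

definition gap_root :: "real set \<Rightarrow> nat \<Rightarrow> real \<Rightarrow> real" where
  "gap_root A k = the_inv_into (gap A k) (recip_sum A)"

lemma recip_square_sum_pos:
  assumes "finite A" "A \<noteq> {}" "y \<notin> A"
  shows "recip_square_sum A y > 0"
  unfolding recip_square_sum_def using assms by (intro sum_pos) auto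

lemma DERIV_recip_sum:
  assumes "y \<notin> A"
  shows "(recip_sum A has_real_derivative - recip_square_sum A y) (at y)"
proof -
  have "((\<lambda>y. \<Sum>a\<in>A. 1 / (y - a)) has_real_derivative (\<Sum>a\<in>A. - (1 / (y - a)\<^sup>2))) (at y)"
    using assms by (auto intro!: derivative_eq_intros simp: power2_eq_square)
  then show ?thesis
    unfolding recip_sum_def[abs_def] recip_square_sum_def by (simp add: sum_negf)
qed

text \<open>The inverse function theorem needs an open domain. \<open>B\<close> runs over the
  possible sets of points of \<open>A\<close> below \<open>y\<close>.\<close>

lemma open_gap:
  assumes "finite A"
  shows "open (gap A k)"
proof -
  have "gap A k = (\<Union>B\<in>{B. B \<subseteq> A \<and> card B = k}. (\<Inter>a\<in>B. {a<..}) \<inter> (\<Inter>a\<in>A - B. {..<a}))"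
  proof (intro equalityI subsetI)
    fix y assume "y \<in> gap A k"
    then have "card {a\<in>A. a < y} = k" "y \<in> (\<Inter>a\<in>A - {a\<in>A. a < y}. {..<a})"
      by (auto simp: gap_def not_less order.order_iff_strict)
    then show "y \<in> (\<Union>B\<in>{B. B \<subseteq> A \<and> card B = k}. (\<Inter>a\<in>B. {a<..}) \<inter> (\<Inter>a\<in>A - B. {..<a}))"
      by (intro UN_I[of "{a\<in>A. a < y}"]) auto
  next
    fix y assume "y \<in> (\<Union>B\<in>{B. B \<subseteq> A \<and> card B = k}. (\<Inter>a\<in>B. {a<..}) \<inter> (\<Inter>a\<in>A - B. {..<a}))"
    then obtain B where B: "B \<subseteq> A" "card B = k" "\<And>a. a \<in> B \<Longrightarrow> a < y"
      "\<And>a. a \<in> A \<Longrightarrow> a \<notin> B \<Longrightarrow> y < a" by auto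
    then have "{a\<in>A. a < y} = B" "y \<notin> A" by force+
    with B show "y \<in> gap A k" by (simp add: gap_def)
  qed
  moreover have "open \<dots>"
    using assms finite_subset by (intro open_UN ballI open_Int open_INT) auto
  ultimately show ?thesis by simp
qed

lemma gap_less:
  assumes "finite A" "u \<in> gap A j" "v \<in> gap A k" "j < k"
  shows "u < v"
proof (rule ccontr)
  assume "\<not> u < v"
  then have "card {a\<in>A. a < v} \<le> card {a\<in>A. a < u}"
    using assms by (intro card_mono) auto
  then show False using assms by (simp add: gap_def)
qed

text \<open>Points of one gap have the same elements of \<open>A\<close> below them, so
  \<open>u - a\<close> and \<open>v - a\<close> have equal sign and every summand decreases.\<close>

lemma recip_sum_less:
  assumes "finite A" "A \<noteq> {}" "u \<in> gap A k" "v \<in> gap A k" "u < v"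
  shows "recip_sum A v < recip_sum A u"
  unfolding recip_sum_def
proof (intro sum_strict_mono assms)
  fix a assume "a \<in> A"
  have "{a\<in>A. a < u} = {a\<in>A. a < v}"
    using assms by (intro card_subset_eq) (auto simp: gap_def)
  then have "a < u \<longleftrightarrow> a < v" using \<open>a \<in> A\<close> by blast
  moreover have "u \<noteq> a" "v \<noteq> a" using assms \<open>a \<in> A\<close> by (auto simp: gap_def)
  ultimately have "0 < (v - a) * (u - a)"
    by (cases "a < u") (auto intro: mult_neg_neg)
  then show "1 / (v - a) < 1 / (u - a)"
    using \<open>u < v\<close> by (intro divide_strict_left_mono) auto
qed

lemma inj_on_recip_sum:
  assumes "finite A" "A \<noteq> {}"
  shows "inj_on (recip_sum A) (gap A k)"
proof (rule inj_onI)
  fix u v assume uv: "u \<in> gap A k" "v \<in> gap A k" "recip_sum A u = recip_sum A v"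
  then show "u = v"
    using recip_sum_less[OF assms uv(1,2)] recip_sum_less[OF assms uv(2,1)]
    by (cases u v rule: linorder_cases) auto
qed

lemma poly_one_minus_D_root_poly:
  assumes "finite A" "y \<notin> A"
  shows "poly (one_minus_D l (root_poly A (\<lambda>x. x))) y =
    poly (root_poly A (\<lambda>x. x)) y * (1 - l * recip_sum A y)"
proof -
  have "poly (pderiv (root_poly A (\<lambda>x. x))) y = poly (root_poly A (\<lambda>x. x)) y * recip_sum A y"
    unfolding recip_sum_def using assms by (intro poly_pderiv_root_poly) auto
  then show ?thesis by (simp add: one_minus_D_def algebra_simps)
qed

text \<open>In the factorization P (1 - l P'/P) the second factor vanishes at \<open>y\<close>, so
  only its derivative contributes.\<close>

lemma poly_pderiv_one_minus_D_root:
  assumes "finite A" "y \<notin> A" "l * recip_sum A y = 1"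
  shows "poly (pderiv (one_minus_D l (root_poly A (\<lambda>x. x)))) y =
    l * poly (root_poly A (\<lambda>x. x)) y * recip_square_sum A y"
proof -
  let ?P = "root_poly A (\<lambda>x. x)"
  have "((\<lambda>y. poly ?P y * (1 - l * recip_sum A y)) has_real_derivative
      poly ?P y * (l * recip_square_sum A y)) (at y)"
    using assms by (auto intro!: derivative_eq_intros DERIV_recip_sum)
  \<comment> \<open>The factorization holds off \<open>A\<close>, which is an open neighbourhood of
    \<open>y\<close>.\<close>
  then have "(poly (one_minus_D l ?P) has_real_derivative poly ?P y * (l * recip_square_sum A y)) (at y)"
    by (rule has_field_derivative_transform_within_open[where S = "- A"])
       (use assms in \<open>auto simp: poly_one_minus_D_root_poly finite_imp_closed\<close>)
  from DERIV_unique[OF poly_DERIV this] show ?thesis by (simp add: mult_ac)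
qed

context
  fixes A :: "real set"
  assumes A: "finite A" "A \<noteq> {}"
begin

text \<open>A simple zero of P is no zero of P - l P', so all zeros lie in \<open>Z\<close>. They
  are simple since the derivative there is \<open>l\<close> P(y) times a positive sum, and
  hyperbolicity makes their number \<open>card A\<close>.\<close>

lemma one_minus_D_simple_roots:
  assumes "l > 0"
  defines "Z \<equiv> {y. y \<notin> A \<and> l * recip_sum A y = 1}"
  shows "finite Z" "card Z = card A" "one_minus_D l (root_poly A (\<lambda>x. x)) = root_poly Z (\<lambda>x. x)"
proof -
  let ?P = "root_poly A (\<lambda>x. x)"
  let ?R = "one_minus_D l ?P"
  have H: "?R \<in> hyperbolic_polys (card A)"
    by (intro one_minus_D_hyperbolic root_poly_hyperbolic)
  have R0: "?R \<noteq> 0"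
    using coeff_degree_one_minus_D[of l ?P] by auto
  have roots: "poly ?R y = 0 \<longleftrightarrow> y \<in> Z" for y
  proof (cases "y \<in> A")
    case True
    then have "poly ?P y = 0" "poly (pderiv ?P) y \<noteq> 0"
      using A by (auto simp: poly_pderiv_root_poly_root[where p = "\<lambda>x. x"] poly_root_poly)
    with True \<open>l > 0\<close> show ?thesis by (auto simp: one_minus_D_def Z_def)
  next
    case False
    then have "poly ?P y \<noteq> 0" using A by (auto simp: poly_root_poly)
    with False show ?thesis using A by (auto simp: poly_one_minus_D_root_poly Z_def)
  qed
  show "finite Z"
    using poly_roots_finite[OF R0] by (simp add: roots)
  have "order y ?R = 1" if "y \<in> Z" for y
  proof -
    have y: "y \<notin> A" "l * recip_sum A y = 1" using that by (auto simp: Z_def)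
    have "poly ?P y \<noteq> 0" using A y by (auto simp: poly_root_poly)
    then have "poly (pderiv ?R) y \<noteq> 0"
      using recip_square_sum_pos[OF A y(1)] \<open>l > 0\<close>
      by (simp add: poly_pderiv_one_minus_D_root[OF A(1) y])
    then have "order y (pderiv ?R) = 0"
      by (rule order_0I)
    with order_pderiv[OF R0] roots[of y] that show ?thesis by simp
  qed
  moreover have "order y ?R = 0" if "y \<notin> Z" for y
    using that roots by (auto intro: order_0I)
  ultimately have proots: "proots ?R = mset_set Z"
    using \<open>finite Z\<close> R0 by (intro multiset_eqI) (auto simp: count_mset_set')
  show "card Z = card A"
    using size_proots_hyperbolic[OF H] by (simp add: proots)
  have "?R = (\<Prod>x\<in>#proots ?R. [:- x, 1:])"
    using H size_proots_hyperbolic[OF H]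
    by (intro prod_mset_proots) (auto simp: hyperbolic_polys_def)
  also have "\<dots> = root_poly Z (\<lambda>x. x)"
    by (simp only: proots) (simp add: root_poly_def prod_unfold_prod_mset)
  finally show "?R = root_poly Z (\<lambda>x. x)" .
qed

text \<open>By injectivity each gap holds at most one zero, and gap 0 holds none because all
  summands are negative there. By counting, the \<open>card A\<close> zeros fill the other
  \<open>card A\<close> gaps.\<close>

lemma gap_index_bij:
  assumes "l > 0"
  shows "bij_betw (\<lambda>y. card {a\<in>A. a < y}) {y. y \<notin> A \<and> l * recip_sum A y = 1} {1..card A}"
    (is "bij_betw ?i ?Z _")
proof -
  have "inj_on ?i ?Z"
  proof (rule inj_onI)
    fix u v assume uv: "u \<in> ?Z" "v \<in> ?Z" "?i u = ?i v"
    then have "u \<in> gap A (?i u)" "v \<in> gap A (?i u)" by (auto simp: gap_def)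
    moreover have "recip_sum A u = recip_sum A v"
      using uv \<open>l > 0\<close> mult_left_cancel[of l "recip_sum A u" "recip_sum A v"] by simp
    ultimately show "u = v" using inj_on_recip_sum[OF A] by (meson inj_onD)
  qed
  moreover have "?i ` ?Z \<subseteq> {1..card A}"
  proof (rule image_subsetI)
    fix y assume y: "y \<in> ?Z"
    have "{a\<in>A. a < y} \<noteq> {}"
    proof
      assume e: "{a\<in>A. a < y} = {}"
      have "1 / (y - a) < 0" if "a \<in> A" for a
        using that y e by (auto simp: divide_less_0_iff not_less order.order_iff_strict)
      then have "recip_sum A y < 0"
        unfolding recip_sum_def using A sum_pos[of A "\<lambda>a. - (1 / (y - a))"] by (simp add: sum_negf)
      then show False using y \<open>l > 0\<close> using mult_pos_neg[of l "recip_sum A y"] by simp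
    qed
    then have "?i y \<noteq> 0" using A by simp
    moreover have "?i y \<le> card A" using A by (intro card_mono) auto
    ultimately show "?i y \<in> {1..card A}" by simp
  qed
  ultimately show ?thesis
    using one_minus_D_simple_roots(2)[OF assms] by (simp add: bij_betw_def card_image card_subset_eq)
qed

text \<open>Surjectivity of the gap index for the parameter \<open>1 / \<mu>\<close> puts
  \<open>\<mu>\<close> into the range of \<open>recip_sum A\<close> on this gap, where the inverse
  is meaningful.\<close>

lemma gap_root:
  assumes "\<mu> > 0" "k \<in> {1..card A}"
  shows "gap_root A k \<mu> \<in> gap A k" "recip_sum A (gap_root A k \<mu>) = \<mu>"
proof -
  have "k \<in> (\<lambda>y. card {a\<in>A. a < y}) ` {y. y \<notin> A \<and> (1 / \<mu>) * recip_sum A y = 1}"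
    using gap_index_bij[of "1 / \<mu>"] assms by (simp add: bij_betw_def)
  then obtain y where y: "y \<in> gap A k" "recip_sum A y = \<mu>"
    using \<open>\<mu> > 0\<close> by (auto simp: gap_def)
  have "gap_root A k \<mu> = y"
    unfolding gap_root_def using the_inv_into_f_f[OF inj_on_recip_sum[OF A] y(1)] y(2) by simp
  with y show "gap_root A k \<mu> \<in> gap A k" "recip_sum A (gap_root A k \<mu>) = \<mu>" by auto
qed

lemma gap_root_bij:
  assumes "l > 0"
  shows "bij_betw (\<lambda>k. gap_root A k (1 / l)) {1..card A} {y. y \<notin> A \<and> l * recip_sum A y = 1}"
    (is "bij_betw ?g _ ?Z")
proof -
  have "1 / l > 0" using assms by simp
  note g = gap_root[OF this]
  have "inj_on ?g {1..card A}"
  proof (rule inj_onI)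
    fix j k assume jk: "j \<in> {1..card A}" "k \<in> {1..card A}" "?g j = ?g k"
    from g(1)[OF jk(1)] g(1)[OF jk(2)] show "j = k" unfolding jk(3) by (simp add: gap_def)
  qed
  moreover have "?g ` {1..card A} \<subseteq> ?Z"
    using g assms by (auto simp: gap_def)
  ultimately show ?thesis
    using one_minus_D_simple_roots(1,2)[OF assms] by (simp add: bij_betw_def card_image card_subset_eq)
qed

lemma DERIV_gap_root:
  assumes "\<mu> > 0" "k \<in> {1..card A}"
  shows "(gap_root A k has_real_derivative - (1 / recip_square_sum A (gap_root A k \<mu>))) (at \<mu>)"
proof -
  note g = gap_root[OF assms]
  let ?y = "gap_root A k \<mu>"
  have y: "?y \<notin> A" using g(1) by (simp add: gap_def)
  have D: "DERIV (recip_sum A) x :> - recip_square_sum A x" if "x \<in> gap A k" for x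
    using that by (intro DERIV_recip_sum) (simp add: gap_def)
  let ?S = "recip_square_sum A ?y"
  have S: "?S > 0" using A y by (rule recip_square_sum_pos)
  have "(gap_root A k has_derivative (\<lambda>h. h * - (1 / ?S))) (at (recip_sum A ?y))"
  proof (rule has_derivative_inverse_strong[where S = "gap A k" and f = "recip_sum A" and x = ?y])
    show "(recip_sum A has_derivative (\<lambda>h. h * - ?S)) (at ?y)"
      using D[OF g(1)] unfolding has_field_derivative_def by (rule has_derivative_eq_rhs) auto
    show "(\<lambda>h. h * - ?S) \<circ> (\<lambda>h. h * - (1 / ?S)) = id"
      using S by (auto simp: fun_eq_iff)
    show "continuous_on (gap A k) (recip_sum A)"
      using D DERIV_isCont by (intro continuous_at_imp_continuous_on) blast
    show "gap_root A k (recip_sum A z) = z" if "z \<in> gap A k" for z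
      unfolding gap_root_def using inj_on_recip_sum[OF A] that by (rule the_inv_into_f_f)
  qed (use g open_gap[OF A(1)] in auto)
  from this[unfolded g(2)] show ?thesis
    unfolding has_field_derivative_def by (rule has_derivative_eq_rhs) auto
qed

section \<open>Monotonicity of weighted sums of zeros\<close>

text \<open>For \<open>l = 1 / \<mu>\<close> the quotient is both the residue P'/R' at the zero and
  the derivative of the zero with respect to \<open>l\<close>; the 1 subtracted is the speed of the
  shift by \<open>l\<close>.\<close>

lemma sum_weighted_gap_root_derivs:
  assumes "\<mu> > 0" and s: "mono_on {1..card A} s"
  shows "(\<Sum>k=1..card A. s k * (\<mu>\<^sup>2 / recip_square_sum A (gap_root A k \<mu>) - 1)) \<ge> 0"
proof -
  define l where "l = 1 / \<mu>"
  have "l > 0" using assms by (simp add: l_def)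
  let ?i = "\<lambda>y. card {a\<in>A. a < y}"
  let ?P = "root_poly A (\<lambda>x. x)"
  define c where "c y = \<mu>\<^sup>2 / recip_square_sum A y" for y
  define Z where "Z = {y. y \<notin> A \<and> l * recip_sum A y = 1}"
  note Z = one_minus_D_simple_roots[OF \<open>l > 0\<close>, folded Z_def]
  have bij: "bij_betw (\<lambda>k. gap_root A k \<mu>) {1..card A} Z"
    using gap_root_bij[OF \<open>l > 0\<close>] by (simp add: l_def Z_def)
  have i: "?i y \<in> {1..card A}" if "y \<in> Z" for y
    using gap_index_bij[OF \<open>l > 0\<close>] that by (auto simp: bij_betw_def Z_def)
  \<comment> \<open>Weights on gaps become weights on zeros through the gap index, which is
    nondecreasing in \<open>y\<close>.\<close>
  have "(\<Sum>y\<in>Z. s (?i y) * (c y - 1)) \<ge> 0"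
  proof (rule sum_weighted_residues_nonneg)
    show "mono_on Z (\<lambda>y. s (?i y))"
    proof (rule mono_onI)
      fix u v assume uv: "u \<in> Z" "v \<in> Z" "u \<le> v"
      then have "?i u \<le> ?i v" using A by (intro card_mono) auto
      then show "s (?i u) \<le> s (?i v)" using s i uv by (auto simp: mono_on_def)
    qed
    show "c y \<ge> 0" if "y \<in> Z" for y
      using that recip_square_sum_pos[OF A, of y] by (auto simp: c_def Z_def)
    show "c y - 1 = l * (\<Sum>z\<in>Z - {y}. (c y + c z) / (y - z))" if "y \<in> Z" for y
    proof (rule residue_identity[OF \<open>finite Z\<close>])
      show "?P = root_poly Z (\<lambda>x. x) + smult l (pderiv ?P)"
        unfolding Z(3)[symmetric] by (simp add: one_minus_D_def)
      show "degree (pderiv ?P) < card Z"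
        using A unfolding Z(2) by (simp add: degree_pderiv card_gt_0_iff)
      show "poly (pderiv ?P) y = c y * poly (root_poly (Z - {y}) (\<lambda>x. x)) y" if "y \<in> Z" for y
      proof -
        have y: "y \<notin> A" "l * recip_sum A y = 1" using that by (auto simp: Z_def)
        have "poly (root_poly (Z - {y}) (\<lambda>x. x)) y = poly (pderiv (root_poly Z (\<lambda>x. x))) y"
          using poly_pderiv_root_poly_root[OF Z(1) that, of "\<lambda>x. x"] by simp
        also have "\<dots> = l * poly ?P y * recip_square_sum A y"
          unfolding Z(3)[symmetric] by (rule poly_pderiv_one_minus_D_root[OF A(1) y])
        finally have "c y * poly (root_poly (Z - {y}) (\<lambda>x. x)) y = \<mu> * poly ?P y"
          using recip_square_sum_pos[OF A y(1)] \<open>\<mu> > 0\<close>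
          by (simp add: c_def l_def power2_eq_square)
        moreover have "poly (pderiv ?P) y = poly ?P y * recip_sum A y"
          unfolding recip_sum_def using A y by (intro poly_pderiv_root_poly) auto
        moreover have "recip_sum A y = \<mu>"
          using y \<open>\<mu> > 0\<close> by (simp add: l_def)
        ultimately show ?thesis by simp
      qed
    qed (rule that)
  qed (use Z \<open>l > 0\<close> in auto)
  also have "(\<Sum>y\<in>Z. s (?i y) * (c y - 1)) =
      (\<Sum>k=1..card A. s (?i (gap_root A k \<mu>)) * (c (gap_root A k \<mu>) - 1))"
    by (rule sum.reindex_bij_betw[OF bij, symmetric])
  also have "\<dots> = (\<Sum>k=1..card A. s k * (c (gap_root A k \<mu>) - 1))"
    using gap_root(1)[OF \<open>\<mu> > 0\<close>] by (intro sum.cong) (auto simp: gap_def)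
  finally show ?thesis by (simp add: c_def)
qed

text \<open>The weights stay fixed while the parameter moves, so differentiation reduces the claim
  to the preceding inequality.\<close>

lemma sum_weighted_gap_root_mono:
  assumes "0 < l" "l \<le> l'" and s: "mono_on {1..card A} s"
  shows "(\<Sum>k=1..card A. s k * (gap_root A k (1 / l) - l)) \<le>
    (\<Sum>k=1..card A. s k * (gap_root A k (1 / l') - l'))"
proof -
  define T where "T \<mu> = (\<Sum>k=1..card A. s k * (gap_root A k \<mu> - 1 / \<mu>))" for \<mu>
  have "T (1 / l') \<ge> T (1 / l)"
  \<comment> \<open>In terms of \<open>\<mu> = 1 / l\<close> the direction is reversed:
    \<open>T\<close> has to be nonincreasing.\<close>
  proof (rule DERIV_nonpos_imp_nonincreasing[where f = T and a = "1 / l'" and b = "1 / l"])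
    show "1 / l' \<le> 1 / l" using assms by (simp add: frac_le)
    fix \<mu> assume "1 / l' \<le> \<mu>" "\<mu> \<le> 1 / l"
    moreover have "1 / l' > 0" using assms by simp
    ultimately have "\<mu> > 0" by linarith
    define S where "S k = recip_square_sum A (gap_root A k \<mu>)" for k
    have "(T has_real_derivative (\<Sum>k=1..card A. s k * (- (1 / S k) + 1 / \<mu>\<^sup>2))) (at \<mu>)"
      unfolding T_def[abs_def] S_def
      using \<open>\<mu> > 0\<close> by (auto intro!: derivative_eq_intros DERIV_gap_root simp: power2_eq_square mult.commute)
    moreover have "(\<Sum>k=1..card A. s k * (- (1 / S k) + 1 / \<mu>\<^sup>2)) =
        - (1 / \<mu>\<^sup>2) * (\<Sum>k=1..card A. s k * (\<mu>\<^sup>2 / S k - 1))"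
      unfolding sum_distrib_left using \<open>\<mu> > 0\<close>
      by (intro sum.cong) (auto simp: algebra_simps)
    moreover have "\<dots> \<le> 0"
      using sum_weighted_gap_root_derivs[OF \<open>\<mu> > 0\<close> s]
      by (intro mult_nonpos_nonneg) (auto simp: S_def)
    ultimately show "\<exists>y. DERIV T \<mu> :> y \<and> y \<le> 0" by auto
  qed
  then show ?thesis by (simp add: T_def)
qed

end

section \<open>From monotone weights to convex functions\<close>

text \<open>\<open>d x\<close> is the infimum of the slopes to the right of \<open>x\<close>. Adding
  the subgradient inequalities at two points shows that \<open>d\<close> is nondecreasing.\<close>

lemma convex_subgradient:
  fixes f :: "real \<Rightarrow> real"
  assumes "convex_on UNIV f"
  shows "\<exists>d. mono d \<and> (\<forall>x y. f y \<ge> f x + d x * (y - x))"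
proof -
  define d where "d x = Inf ((\<lambda>t. (f x - f t) / (x - t)) ` ({x<..} \<inter> UNIV))" for x
  have d: "f y \<ge> f x + d x * (y - x)" for x y
    unfolding d_def by (rule convex_le_Inf_differential[OF assms]) auto
  have "mono d"
  proof
    fix x y :: real assume "x \<le> y"
    show "d x \<le> d y"
    proof (cases "x = y")
      case False
      have "d x * (y - x) \<le> d y * (y - x)"
        using d[where x = x and y = y] d[where x = y and y = x] by (simp add: algebra_simps)
      with False \<open>x \<le> y\<close> show ?thesis by simp
    qed simp
  qed
  with d show ?thesis by blast
qed

text \<open>The subgradient inequality at the zeros for \<open>l\<close> bounds the difference of
  the sums below by a weighted sum of displacements.\<close>

lemma convex_sum_gap_root_mono:
  assumes A: "finite A" "A \<noteq> {}" and l: "0 < l" "l \<le> l'" and f: "convex_on UNIV f"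
  shows "(\<Sum>k=1..card A. f (gap_root A k (1 / l) - l)) \<le>
    (\<Sum>k=1..card A. f (gap_root A k (1 / l') - l'))"
proof -
  obtain d where "mono d" and d: "\<And>x y. f y \<ge> f x + d x * (y - x)"
    using convex_subgradient[OF f] by blast
  define x where "x k = gap_root A k (1 / l) - l" for k
  define x' where "x' k = gap_root A k (1 / l') - l'" for k
  \<comment> \<open>Zeros in later gaps are larger, so the subgradients form admissible
    weights.\<close>
  have "mono_on {1..card A} (\<lambda>k. d (x k))"
  proof (rule mono_onI)
    fix j k assume jk: "j \<in> {1..card A}" "k \<in> {1..card A}" "j \<le> k"
    have "1 / l > 0" using l by simp
    then have "x j \<le> x k"
      using gap_less[OF A(1) gap_root(1)[OF A _ jk(1)] gap_root(1)[OF A _ jk(2)], of "1 / l" "1 / l"] jk(3)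
      by (cases "j = k") (auto simp: x_def)
    then show "d (x j) \<le> d (x k)" using \<open>mono d\<close> by (rule monoD[rotated])
  qed
  from sum_weighted_gap_root_mono[OF A l this]
  have "0 \<le> (\<Sum>k=1..card A. d (x k) * (x' k - x k))"
    by (simp add: x_def x'_def right_diff_distrib sum_subtractf)
  also have "\<dots> \<le> (\<Sum>k=1..card A. f (x' k) - f (x k))"
    using d by (intro sum_mono) (simp add: algebra_simps)
  finally show ?thesis by (simp add: x_def x'_def sum_subtractf)
qed

lemma proots_one_minus_D_exp_D_simple:
  assumes A: "finite A" "A \<noteq> {}" and "l > 0"
  shows "proots (one_minus_D l (exp_D l (root_poly A (\<lambda>x. x)))) =
    image_mset (\<lambda>k. gap_root A k (1 / l) - l) (mset_set {1..card A})"
proof -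
  define Z where "Z = {y. y \<notin> A \<and> l * recip_sum A y = 1}"
  have bij: "bij_betw (\<lambda>k. gap_root A k (1 / l)) {1..card A} Z"
    unfolding Z_def by (rule gap_root_bij[OF assms])
  have "proots (one_minus_D l (exp_D l (root_poly A (\<lambda>x. x)))) = image_mset (\<lambda>y. y - l) (mset_set Z)"
    unfolding one_minus_D_exp_D_root_poly[OF one_minus_D_simple_roots(3)[OF assms, folded Z_def]]
    by (rule proots_root_poly)
  also have "mset_set Z = image_mset (\<lambda>k. gap_root A k (1 / l)) (mset_set {1..card A})"
    using bij by (simp add: bij_betw_def image_mset_mset_set)
  finally show ?thesis by (simp add: image_mset.compositionality o_def)
qed

lemma convex_sum_proots_simple:
  assumes A: "finite A" and l: "0 < l" "l \<le> l'" and f: "convex_on UNIV f"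
  shows "(\<Sum>x\<in>#proots (one_minus_D l (exp_D l (root_poly A (\<lambda>x. x)))). f x) \<le>
    (\<Sum>x\<in>#proots (one_minus_D l' (exp_D l' (root_poly A (\<lambda>x. x)))). f x)"
proof (cases "A = {}")
  case True
  have "one_minus_D m (exp_D m 1) = 1" for m
    by (simp add: one_minus_D_def exp_D_def)
  with True show ?thesis by (simp add: root_poly_def)
next
  case False
  have "l' > 0" using l by simp
  with convex_sum_gap_root_mono[OF A False l f] show ?thesis
    by (simp add: proots_one_minus_D_exp_D_simple[OF A False] l image_mset.compositionality o_def
        sum_unfold_sum_mset)
qed

subsection \<open>Multiple zeros and reflection\<close>

text \<open>Bolzano-Weierstrass one coordinate at a time; passing to a further subsequence keeps the
  limits already found.\<close>

lemma bounded_seqs_common_convergent_subseq: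
  fixes u :: "nat \<Rightarrow> nat \<Rightarrow> real"
  assumes "\<And>i m. i < n \<Longrightarrow> \<bar>u m i\<bar> \<le> B"
  shows "\<exists>r v. strict_mono r \<and> (\<forall>i<n. (\<lambda>m. u (r m) i) \<longlonglongrightarrow> v i)"
  using assms
proof (induction n)
  case 0
  then show ?case using strict_mono_id by blast
next
  case (Suc n)
  then obtain r v where r: "strict_mono r" "\<And>i. i < n \<Longrightarrow> (\<lambda>m. u (r m) i) \<longlonglongrightarrow> v i"
    by force
  have "bounded (range (\<lambda>m. u (r m) n))"
    using Suc.prems[of n] by (intro boundedI[of _ B]) auto
  then obtain w r' where r': "strict_mono r'" "((\<lambda>m. u (r m) n) \<circ> r') \<longlonglongrightarrow> w"
    using bounded_imp_convergent_subsequence by blast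
  have "(\<lambda>m. u ((r \<circ> r') m) i) \<longlonglongrightarrow> (v(n := w)) i" if "i < Suc n" for i
  proof (cases "i = n")
    case True
    then show ?thesis using r'(2) by (simp add: o_def)
  next
    case False
    then have "((\<lambda>m. u (r m) i) \<circ> r') \<longlonglongrightarrow> v i"
      using r(2) r'(1) that by (intro LIMSEQ_subseq_LIMSEQ) auto
    then show ?thesis using False by (simp add: o_def)
  qed
  moreover have "strict_mono (r \<circ> r')" using r(1) r'(1) by (rule strict_mono_o)
  ultimately show ?case by blast
qed

text \<open>If \<open>y\<close> were farther than \<open>n * l\<close> from every
  \<open>p i\<close>, each of the \<open>n\<close> terms of l P'/P would be below
  \<open>1 / n\<close> in absolute value, yet their sum is 1.\<close>

lemma root_one_minus_D_bound:
  fixes p :: "nat \<Rightarrow> real"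
  assumes "l \<ge> 0" "poly (one_minus_D l (root_poly {..<n} p)) y = 0"
  shows "\<exists>i<n. \<bar>y - p i\<bar> \<le> n * l"
proof (rule ccontr)
  assume "\<not> (\<exists>i<n. \<bar>y - p i\<bar> \<le> n * l)"
  then have far: "n * l < \<bar>y - p i\<bar>" if "i < n" for i using that by force
  have "n * l \<ge> 0" using assms by simp
  then have y: "y \<notin> p ` {..<n}" using far by force
  then have "poly (root_poly {..<n} p) y \<noteq> 0" by (auto simp: poly_root_poly)
  moreover have "poly (root_poly {..<n} p) y * (1 - l * (\<Sum>i<n. 1 / (y - p i))) = 0"
    using assms(2) poly_pderiv_root_poly[OF finite_lessThan y]
    by (simp add: one_minus_D_def algebra_simps)
  ultimately have one: "(\<Sum>i<n. l / (y - p i)) = 1"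
    by (simp add: sum_distrib_left)
  then have "n > 0" by (cases n) auto
  have "1 \<le> (\<Sum>i<n. \<bar>l / (y - p i)\<bar>)"
    using sum_abs[of "\<lambda>i. l / (y - p i)" "{..<n}"] one by simp
  also have "\<dots> < (\<Sum>i<n. 1 / n)"
  proof (intro sum_strict_mono)
    fix i assume "i \<in> {..<n}"
    then have "n * l < \<bar>y - p i\<bar>" by (simp add: far)
    moreover from this have "0 < \<bar>y - p i\<bar>" using \<open>n * l \<ge> 0\<close> by linarith
    ultimately show "\<bar>l / (y - p i)\<bar> < 1 / n"
      using \<open>n > 0\<close> \<open>l \<ge> 0\<close> by (simp add: divide_simps mult.commute)
  qed (use \<open>n > 0\<close> in auto)
  also have "\<dots> = 1" using \<open>n > 0\<close> by simp
  finally show False by simp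
qed

text \<open>Free of division, this form is continuous in \<open>l\<close> and all \<open>p i\<close>
  at every \<open>x\<close>.\<close>

lemma poly_one_minus_D_root_poly_eq:
  fixes p :: "nat \<Rightarrow> real"
  shows "poly (one_minus_D l (root_poly I p)) x =
    (\<Prod>i\<in>I. x - p i) - l * (\<Sum>i\<in>I. \<Prod>j\<in>I - {i}. x - p j)"
  by (simp add: one_minus_D_def pderiv_root_poly poly_sum poly_root_poly)

lemma one_minus_D_exp_D_eq_root_poly:
  assumes "P \<in> hyperbolic_polys n"
  obtains u where "one_minus_D l (exp_D l P) = root_poly {..<n} u"
  using hyperbolic_polysE[OF one_minus_D_hyperbolic[OF assms, of l]] one_minus_D_exp_D_root_poly by metis

text \<open>The zeros stay bounded, so some subsequence of the zero tuples converges, and pointwise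
  convergence of the polynomials identifies the limit. The tuples \<open>u m\<close> come in
  arbitrary order, hence the subsequence.\<close>

lemma sum_proots_convergent_subseq:
  fixes f :: "real \<Rightarrow> real" and p :: "nat \<Rightarrow> nat \<Rightarrow> real"
  assumes f: "continuous_on UNIV f"
    and p: "\<And>i. i < n \<Longrightarrow> (\<lambda>m. p m i) \<longlonglongrightarrow> q i"
    and l: "l \<longlonglongrightarrow> l0" "\<And>m. l m \<ge> 0"
  shows "\<exists>r. strict_mono r \<and>
    (\<lambda>m. \<Sum>x\<in>#proots (one_minus_D (l (r m)) (exp_D (l (r m)) (root_poly {..<n} (p (r m))))). f x)
      \<longlonglongrightarrow> (\<Sum>x\<in>#proots (one_minus_D l0 (exp_D l0 (root_poly {..<n} q))). f x)"
proof -
  define Q where "Q m = one_minus_D (l m) (exp_D (l m) (root_poly {..<n} (p m)))" for m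
  define Q0 where "Q0 = one_minus_D l0 (exp_D l0 (root_poly {..<n} q))"
  have "\<exists>u. Q m = root_poly {..<n} u" for m
    using one_minus_D_exp_D_eq_root_poly[OF root_poly_hyperbolic[of "{..<n}" "p m"]]
    unfolding Q_def by (metis card_lessThan)
  then obtain u where u: "\<And>m. Q m = root_poly {..<n} (u m)" by metis
  obtain D where D: "\<And>m. l m \<le> D"
    using convergent_imp_Bseq[OF convergentI[OF l(1)]] by (auto simp: Bseq_def abs_le_iff)
  have "\<exists>C. \<forall>m. \<bar>p m i\<bar> \<le> C \<and> 0 \<le> C" if "i < n" for i
    using convergent_imp_Bseq[OF convergentI[OF p[OF that]]] by (force simp: Bseq_def)
  then obtain C where C: "\<And>m i. i < n \<Longrightarrow> \<bar>p m i\<bar> \<le> C i" "\<And>i. i < n \<Longrightarrow> 0 \<le> C i"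
    by metis
  \<comment> \<open>\<open>n * D\<close> bounds the distance to a zero \<open>p m j\<close>, the
    second \<open>D\<close> the translation by \<open>l m\<close>, and the sum dominates every
    \<open>C j\<close>.\<close>
  have bound: "\<bar>u m i\<bar> \<le> n * D + D + (\<Sum>i<n. C i)" if "i < n" for m i
  proof -
    have "poly (Q m) (u m i) = 0" using that by (auto simp: u poly_root_poly)
    then have "poly (one_minus_D (l m) (root_poly {..<n} (p m))) (u m i + l m) = 0"
      unfolding Q_def by (simp add: poly_one_minus_D_exp_D)
    from root_one_minus_D_bound[OF l(2) this]
    obtain j where j: "j < n" "\<bar>u m i + l m - p m j\<bar> \<le> n * l m" by auto
    have "C j \<le> (\<Sum>i<n. C i)" using j(1) C by (intro member_le_sum) auto
    moreover have "n * l m \<le> n * D" using D by (intro mult_left_mono) auto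
    ultimately show ?thesis using j(2) C(1)[OF j(1), of m] D[of m] l(2)[of m] by linarith
  qed
  obtain r v where r: "strict_mono r" and v: "\<And>i. i < n \<Longrightarrow> (\<lambda>m. u (r m) i) \<longlonglongrightarrow> v i"
    using bounded_seqs_common_convergent_subseq[of n u, OF bound] by blast
  have "poly Q0 x = poly (root_poly {..<n} v) x" for x
  proof (rule LIMSEQ_unique)
    show "(\<lambda>m. poly (Q (r m)) x) \<longlonglongrightarrow> poly (root_poly {..<n} v) x"
      unfolding u poly_root_poly using v by (intro tendsto_intros) auto
    have "(\<lambda>m. poly (Q m) x) \<longlonglongrightarrow> poly Q0 x"
      unfolding Q_def Q0_def poly_one_minus_D_exp_D poly_one_minus_D_root_poly_eq
      using p l(1) by (intro tendsto_intros) auto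
    then show "(\<lambda>m. poly (Q (r m)) x) \<longlonglongrightarrow> poly Q0 x"
      using LIMSEQ_subseq_LIMSEQ[OF _ r] by (fastforce simp: o_def)
  qed
  then have "Q0 = root_poly {..<n} v"
    by (simp add: poly_eq_poly_eq_iff[symmetric] fun_eq_iff)
  then have Q0: "(\<Sum>x\<in>#proots Q0. f x) = (\<Sum>i<n. f (v i))"
    by (simp add: proots_root_poly image_mset.compositionality o_def sum_unfold_sum_mset)
  have "(\<lambda>m. \<Sum>i<n. f (u (r m) i)) \<longlonglongrightarrow> (\<Sum>i<n. f (v i))"
    using v f by (intro tendsto_sum continuous_on_tendsto_compose[OF f]) auto
  moreover have "(\<Sum>x\<in>#proots (Q m). f x) = (\<Sum>i<n. f (u m i))" for m
    by (simp add: u proots_root_poly image_mset.compositionality o_def sum_unfold_sum_mset)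
  ultimately show ?thesis
    using r Q0 unfolding Q_def Q0_def by auto
qed

lemma root_poly_image:
  "inj_on p I \<Longrightarrow> root_poly (p ` I) (\<lambda>x. x) = root_poly I p"
  by (simp add: root_poly_def prod.reindex)

text \<open>The case of simple zeros and positive parameters is applied to perturbed data, followed
  by a limit.\<close>

lemma convex_sum_proots_nonneg:
  assumes P: "P \<in> hyperbolic_polys n" and l: "0 \<le> l" "l \<le> l'" and f: "convex_on UNIV f"
  shows "(\<Sum>x\<in>#proots (one_minus_D l (exp_D l P)). f x) \<le>
    (\<Sum>x\<in>#proots (one_minus_D l' (exp_D l' P)). f x)"
proof -
  obtain p where p: "P = root_poly {..<n} p" "mono_on {..<n} p"
    using hyperbolic_polysE[OF P] .
  define t where "t m = inverse (real (Suc m))" for m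
  \<comment> \<open>Since \<open>p\<close> is nondecreasing, these zeros are strictly increasing in
    \<open>i\<close>.\<close>
  define q where "q m i = p i + t m * real i" for m i
  have t: "t \<longlonglongrightarrow> 0" unfolding t_def by (rule LIMSEQ_inverse_real_of_nat)
  have t0: "t m > 0" for m by (simp add: t_def)
  have t_nonneg: "k \<ge> 0 \<Longrightarrow> k + t m \<ge> 0" for k m using t0[of m] by simp
  \<comment> \<open>Shifting both parameters by \<open>t m\<close> makes them positive and preserves
    their order.\<close>
  define F where "F k m = (\<Sum>x\<in>#proots (one_minus_D (k + t m) (exp_D (k + t m) (root_poly {..<n} (q m)))). f x)"
    for k m
  have q: "(\<lambda>m. q m i) \<longlonglongrightarrow> p i" for i
    unfolding q_def using tendsto_add[OF tendsto_const tendsto_mult_left_zero[OF t]] by force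
  have lt: "(\<lambda>m. k + t m) \<longlonglongrightarrow> k" for k
    using tendsto_add[OF tendsto_const t, of k] by simp
  have cont: "continuous_on UNIV f" using f by (intro convex_on_continuous) auto
  have le: "F l m \<le> F l' m" for m
  proof -
    have "inj_on (q m) {..<n}"
    proof (rule linorder_inj_onI)
      fix i j assume ij: "i < j" "i \<in> {..<n}" "j \<in> {..<n}"
      then have "p i \<le> p j" using p(2) by (auto simp: mono_on_def)
      moreover have "t m * real i < t m * real j" using ij t0 by simp
      ultimately show "q m i \<noteq> q m j" by (simp add: q_def)
    qed auto
    then show ?thesis
      using convex_sum_proots_simple[of "q m ` {..<n}" "l + t m" "l' + t m" f] t0[of m] l f
      by (simp add: F_def root_poly_image)
  qed
  obtain r where r: "strict_mono r"
    "(\<lambda>m. F l (r m)) \<longlonglongrightarrow> (\<Sum>x\<in>#proots (one_minus_D l (exp_D l P)). f x)"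
    using sum_proots_convergent_subseq[of f n q p "\<lambda>m. l + t m" l, OF cont q lt t_nonneg[OF l(1)]]
    unfolding F_def p(1) by blast
  \<comment> \<open>The subsequence for \<open>l'\<close> is chosen inside the one for
    \<open>l\<close>, so that both limits hold along a common subsequence.\<close>
  have qr: "(\<lambda>m. q (r m) i) \<longlonglongrightarrow> p i" for i
    using LIMSEQ_subseq_LIMSEQ[OF q r(1)] by (simp add: o_def)
  have ltr: "(\<lambda>m. l' + t (r m)) \<longlonglongrightarrow> l'"
    using LIMSEQ_subseq_LIMSEQ[OF lt r(1)] by (simp add: o_def)
  have l'0: "l' \<ge> 0" using l by simp
  obtain r' where r': "strict_mono r'"
    "(\<lambda>m. F l' (r (r' m))) \<longlonglongrightarrow> (\<Sum>x\<in>#proots (one_minus_D l' (exp_D l' P)). f x)"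
    using sum_proots_convergent_subseq[of f n "\<lambda>m. q (r m)" p "\<lambda>m. l' + t (r m)" l',
        OF cont qr ltr t_nonneg[OF l'0]]
    unfolding F_def p(1) by blast
  have "(\<lambda>m. F l (r (r' m))) \<longlonglongrightarrow> (\<Sum>x\<in>#proots (one_minus_D l (exp_D l P)). f x)"
    using LIMSEQ_subseq_LIMSEQ[OF r(2) r'(1)] by (simp add: o_def)
  from LIMSEQ_le[OF this r'(2)] le show ?thesis by blast
qed

section \<open>Reflection to negative parameters\<close>

text \<open>The sign keeps the reflected polynomial monic.\<close>

lemma root_poly_uminus:
  fixes p :: "'i \<Rightarrow> real"
  shows "root_poly I (\<lambda>i. - p i) = smult ((-1) ^ card I) (pcompose (root_poly I p) [:0, -1:])"
proof -
  have "poly (root_poly I (\<lambda>i. - p i)) x =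
      poly (smult ((-1) ^ card I) (pcompose (root_poly I p) [:0, -1:])) x" for x
  proof -
    have "(\<Prod>i\<in>I. x + p i) = (\<Prod>i\<in>I. -1 * (- x - p i))"
      by (simp add: add.commute)
    also have "\<dots> = (-1) ^ card I * (\<Prod>i\<in>I. - x - p i)"
      by (subst prod.distrib) simp
    finally show ?thesis by (simp add: poly_root_poly poly_pcompose)
  qed
  then show ?thesis by (simp add: poly_eq_poly_eq_iff[symmetric] fun_eq_iff)
qed

text \<open>The substitution of \<open>- x\<close> for \<open>x\<close> turns D into -D, hence
  \<open>l\<close> into \<open>- l\<close> in both operators.\<close>

lemma one_minus_D_exp_D_uminus:
  fixes p :: "'i \<Rightarrow> real"
  assumes "one_minus_D l (exp_D l (root_poly I p)) = root_poly I u"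
  shows "one_minus_D (- l) (exp_D (- l) (root_poly I (\<lambda>i. - p i))) = root_poly I (\<lambda>i. - u i)"
proof -
  have "poly (one_minus_D (- l) (exp_D (- l) (root_poly I (\<lambda>i. - p i)))) x = poly (root_poly I (\<lambda>i. - u i)) x" for x
  proof -
    have "poly (one_minus_D (- l) (exp_D (- l) (root_poly I (\<lambda>i. - p i)))) x =
        (-1) ^ card I * poly (one_minus_D l (root_poly I p)) (- x + l)"
      unfolding poly_one_minus_D_exp_D root_poly_uminus
      by (simp add: one_minus_D_def pderiv_smult pderiv_pcompose pderiv_pCons poly_pcompose algebra_simps)
    also have "\<dots> = (-1) ^ card I * poly (root_poly I u) (- x)"
      unfolding assms[symmetric] poly_one_minus_D_exp_D ..
    also have "\<dots> = poly (root_poly I (\<lambda>i. - u i)) x"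
      unfolding root_poly_uminus by (simp add: poly_pcompose)
    finally show ?thesis .
  qed
  then show ?thesis by (simp add: poly_eq_poly_eq_iff[symmetric] fun_eq_iff)
qed

text \<open>The sign condition makes both parameters nonnegative or both nonpositive; the second
  case is reflected into the first.\<close>

lemma convex_sum_proots:
  assumes P: "P \<in> hyperbolic_polys n" and l: "l * l' \<ge> 0" "\<bar>l\<bar> \<le> \<bar>l'\<bar>" and f: "convex_on UNIV f"
  shows "(\<Sum>x\<in>#proots (one_minus_D l (exp_D l P)). f x) \<le>
    (\<Sum>x\<in>#proots (one_minus_D l' (exp_D l' P)). f x)"
proof (cases "0 \<le> l \<and> 0 \<le> l'")
  case True
  then show ?thesis using l by (intro convex_sum_proots_nonneg[OF P _ _ f]) auto
next
  case False
  then have neg: "0 \<le> - l" "- l \<le> - l'"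
    using l by (auto simp: zero_le_mult_iff)
  obtain p where p: "P = root_poly {..<n} p"
    using hyperbolic_polysE[OF P] .
  \<comment> \<open>The reflection of the zeros cancels against that of the argument of
    \<open>f\<close>.\<close>
  have refl: "(\<Sum>x\<in>#proots (one_minus_D (- k) (exp_D (- k) (root_poly {..<n} (\<lambda>i. - p i)))). f (- x)) =
      (\<Sum>x\<in>#proots (one_minus_D k (exp_D k P)). f x)" for k
  proof -
    obtain u where u: "one_minus_D k (exp_D k P) = root_poly {..<n} u"
      using one_minus_D_exp_D_eq_root_poly[OF P] .
    show ?thesis
      unfolding one_minus_D_exp_D_uminus[OF u[unfolded p]] u
      by (simp add: proots_root_poly image_mset.compositionality o_def)
  qed
  have "convex_on UNIV (\<lambda>x. f (- x))"
  proof (intro convex_onI)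
    fix t x y :: real assume "0 < t" "t < 1"
    then show "f (- ((1 - t) *\<^sub>R x + t *\<^sub>R y)) \<le> (1 - t) * f (- x) + t * f (- y)"
      using convex_onD[OF f, of t "- x" "- y"] by simp
  qed simp
  moreover have "root_poly {..<n} (\<lambda>i. - p i) \<in> hyperbolic_polys n"
    using root_poly_hyperbolic[of "{..<n}"] by simp
  ultimately show ?thesis
    using convex_sum_proots_nonneg[OF _ neg, of "root_poly {..<n} (\<lambda>i. - p i)" n "\<lambda>x. f (- x)"]
    by (simp add: refl)
qed

theorem theorem3:
  fixes n :: nat and l\<^sub>1 l\<^sub>2 :: real and P :: "real poly"
  assumes "n \<ge> 1"
    and "l\<^sub>1 * l\<^sub>2 \<ge> 0"
    and "\<bar>l\<^sub>1\<bar> \<le> \<bar>l\<^sub>2\<bar>"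
    and "P \<in> hyperbolic_polys n"
  shows "poly_spectral_le n (one_minus_D l\<^sub>1 (exp_D l\<^sub>1 P)) (one_minus_D l\<^sub>2 (exp_D l\<^sub>2 P))"
proof -
  have H: "one_minus_D l (exp_D l P) \<in> hyperbolic_polys n" for l
  proof -
    obtain u where "one_minus_D l (exp_D l P) = root_poly {..<n} u"
      using one_minus_D_exp_D_eq_root_poly[OF assms(4)] .
    then show ?thesis using root_poly_hyperbolic[of "{..<n}" u] by simp
  qed
  then show ?thesis
    using convex_sum_proots[OF assms(4,2,3)] size_proots_hyperbolic[OF H]
    by (simp add: poly_spectral_le_def spectral_le_def)
qed

end
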